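(* Let $A_1=\mathbb{C}[x]/(x^2)$ and let $A_3=A_1\otimes_{\mathbb{C}} A_1\otimes_{\mathbb{C}} A_1\cong\mathbb{C}[x,y,z]/(x^2,y^2,z^2)$. The multiplication tensor $T_{A_3}\in\mathbb{C}^8\otimes\mathbb{C}^8\otimes\mathbb{C}^8$ of $A_3$ (equivalently, the third Kronecker power of the multiplication tensor of $A_1$) is not isomorphic to the Coppersmith--Winograd tensor $T_{CW,6}$, but it degenerates to it: $T_{A_3}\trianglerighteq T_{CW,6}$.
   Context: The multiplication map $A\otimes A\to A$ of a finite-dimensional $\mathbb{C}$-algebra $A$ is viewed as a tensor $T_A\in A^*\otimes A^*\otimes A$; after choosing bases of the three factors it is a tensor in $\mathbb{C}^d\otimes\mathbb{C}^d\otimes\mathbb{C}^d$, $d=\dim A$, well defined up to isomorphism. Two tensors in $U\otimes V\otimes W$ are isomorphic if they lie in the same orbit of $GL(U)\times GL(V)\times GL(W)$; $T'$ is a degeneration of $T$, written $T\trianglerighteq T'$, if $T'$ lies in the closure of the $GL(U)\times GL(V)\times GL(W)$-orbit of $T$. The Kronecker product of $T\in U\otimes V\otimes W$ and $T'\in U'\otimes V'\otimes W'$ is $T\otimes T'$ viewed as a 3-way tensor in $(U\otimes U')\otimes(V\otimes V')\otimes(W\otimes W')$. The Coppersmith--Winograd tensor is $T_{CW,6}=3x_0^2x_7+3\sum_{i=1}^6x_0x_i^2\in S^3(\mathbb{C}^8)\subset\mathbb{C}^8\otimes\mathbb{C}^8\otimes\mathbb{C}^8$, where $x_0,\dots,x_7$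 is a basis of $\mathbb{C}^8$ and $uvw$ denotes the average of the six tensors obtained from $u\otimes v\otimes w$ by permuting the factors. *)

theory Defs
  imports
    "HOL-Analysis.Analysis"
    "HOL-Computational_Algebra.Polynomial"
    "HOL-Library.Poly_Mapping"
begin

text \<open>
  A tensor in $\mathbb{C}^a \otimes \mathbb{C}^b \otimes \mathbb{C}^c$ is its coordinate array,
  the entry with indices $i, j, k$ being \<open>T $ i $ j $ k\<close>.
\<close>

type_synonym ('a, 'b, 'c) tensor3 = "complex ^ 'c ^ 'b ^ 'a"

text \<open>
  The index types of source and target may differ: an invertible \<open>P :: complex ^ 'a ^ 'd\<close> is a
  linear isomorphism between two spaces with chosen bases. If the index types agree, the triples
  of invertible matrices form the group $GL(U) \times GL(V) \times GL(W)$.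
\<close>

definition tensor_act ::
  "complex ^ 'a ^ 'd \<Rightarrow> complex ^ 'b ^ 'e \<Rightarrow> complex ^ 'c ^ 'f \<Rightarrow>
    ('a::finite, 'b::finite, 'c::finite) tensor3 \<Rightarrow> ('d::finite, 'e::finite, 'f::finite) tensor3"
  where "tensor_act P Q R T =
    (\<chi> l m n. \<Sum>i\<in>UNIV. \<Sum>j\<in>UNIV. \<Sum>k\<in>UNIV. P $ l $ i * Q $ m $ j * R $ n $ k * T $ i $ j $ k)"

definition tensor_orbit ::
  "('a::finite, 'b::finite, 'c::finite) tensor3 \<Rightarrow> ('d::finite, 'e::finite, 'f::finite) tensor3 set"
  where "tensor_orbit T =
    {tensor_act P Q R T | P Q R. invertible P \<and> invertible Q \<and> invertible R}"

definition tensor_isomorphic ::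
  "('a::finite, 'b::finite, 'c::finite) tensor3 \<Rightarrow> ('d::finite, 'e::finite, 'f::finite) tensor3 \<Rightarrow> bool"
  where "tensor_isomorphic T T' \<longleftrightarrow> T' \<in> tensor_orbit T"

definition degenerates_to ::
  "('a::finite, 'b::finite, 'c::finite) tensor3 \<Rightarrow> ('a, 'b, 'c) tensor3 \<Rightarrow> bool"
    (infix \<open>\<unrhd>\<close> 50)
  where "T \<unrhd> T' \<longleftrightarrow> T' \<in> closure (tensor_orbit T)"

definition kronecker ::
  "('a::finite, 'b::finite, 'c::finite) tensor3 \<Rightarrow> ('d::finite, 'e::finite, 'f::finite) tensor3 \<Rightarrow>
    ('a \<times> 'd, 'b \<times> 'e, 'c \<times> 'f) tensor3"
  where "kronecker T T' =
    (\<chi> p q r. T $ fst p $ fst q $ fst r * T' $ snd p $ snd q $ snd r)"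

text \<open>
  A finite-dimensional algebra is a ring type together with a scalar multiplication. The
  multiplication tensor in $A^* \otimes A^* \otimes A$ is written in the bases dual to \<open>e\<close> and \<open>f\<close>
  in the first two factors and the basis \<open>g\<close> in the third; every basis of $A^*$ is the dual of a
  basis of $A$.
\<close>

definition is_basis :: "(complex \<Rightarrow> 'v \<Rightarrow> 'v) \<Rightarrow> ('n \<Rightarrow> 'v::ab_group_add) \<Rightarrow> bool"
  where "is_basis sc b \<longleftrightarrow>
    inj b \<and> \<not> module.dependent sc (range b) \<and> module.span sc (range b) = UNIV"

definition mult_tensor ::
  "(complex \<Rightarrow> 'r \<Rightarrow> 'r) \<Rightarrow> ('a::finite \<Rightarrow> 'r::ring) \<Rightarrow> ('b::finite \<Rightarrow> 'r) \<Rightarrow> ('c::finite \<Rightarrow> 'r) \<Rightarrow>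
    ('a, 'b, 'c) tensor3"
  where "mult_tensor sc e f g =
    (\<chi> i j k. module.representation sc (range g) (e i * f j) (g k))"

quotient_type A1 = "complex poly" / "\<lambda>p q. [:0, 1:] ^ 2 dvd p - q"
proof (rule equivpI)
  show "reflp (\<lambda>p q :: complex poly. [:0, 1:] ^ 2 dvd p - q)"
    by (simp add: reflp_def)
  show "symp (\<lambda>p q :: complex poly. [:0, 1:] ^ 2 dvd p - q)"
    by (auto simp: symp_def dvd_diff_commute)
  show "transp (\<lambda>p q :: complex poly. [:0, 1:] ^ 2 dvd p - q)"
    unfolding transp_def
  proof (intro allI impI)
    fix p q r :: "complex poly"
    assume "[:0, 1:] ^ 2 dvd p - q" "[:0, 1:] ^ 2 dvd q - r"
    then have "[:0, 1:] ^ 2 dvd (p - q) + (q - r)"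
      by (rule dvd_add)
    then show "[:0, 1:] ^ 2 dvd p - r"
      by simp
  qed
qed

instantiation A1 :: comm_ring_1
begin

lift_definition zero_A1 :: A1 is 0 .
lift_definition one_A1 :: A1 is 1 .
lift_definition plus_A1 :: "A1 \<Rightarrow> A1 \<Rightarrow> A1" is "(+)"
  by (metis add_diff_add dvd_add)
lift_definition minus_A1 :: "A1 \<Rightarrow> A1 \<Rightarrow> A1" is "(-)"
proof -
  fix p p' q q' :: "complex poly"
  assume "[:0, 1:] ^ 2 dvd p - p'" "[:0, 1:] ^ 2 dvd q - q'"
  then have "[:0, 1:] ^ 2 dvd (p - p') - (q - q')"
    by (rule dvd_diff)
  then show "[:0, 1:] ^ 2 dvd p - q - (p' - q')"
    by (simp add: algebra_simps)
qed
lift_definition uminus_A1 :: "A1 \<Rightarrow> A1" is uminus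
  by (metis dvd_minus_iff minus_diff_minus)
lift_definition times_A1 :: "A1 \<Rightarrow> A1 \<Rightarrow> A1" is "(*)"
proof -
  fix p p' q q' :: "complex poly"
  assume "[:0, 1:] ^ 2 dvd p - p'" "[:0, 1:] ^ 2 dvd q - q'"
  then have "[:0, 1:] ^ 2 dvd (p - p') * q + p' * (q - q')"
    by (intro dvd_add dvd_mult dvd_mult2)
  then show "[:0, 1:] ^ 2 dvd p * q - p' * q'"
    by (simp add: algebra_simps)
qed

instance
proof
  show "(0::A1) \<noteq> 1"
  proof (transfer, rule notI)
    assume "[:0, 1:] ^ 2 dvd (0 - 1 :: complex poly)"
    then have "[:0, 1:] ^ 2 dvd (1 :: complex poly)"
      by (metis diff_0 dvd_minus_iff)
    then obtain q :: "complex poly" where "1 = [:0, 1:] ^ 2 * q" ..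
    then have "poly 1 0 = poly ([:0, 1:] ^ 2 * q) (0::complex)"
      by simp
    then show False
      by simp
  qed
qed (transfer; simp add: algebra_simps)+

end

lift_definition scale_A1 :: "complex \<Rightarrow> A1 \<Rightarrow> A1" is smult
  by (metis dvd_smult smult_diff_right)

text \<open>
  The algebra $A_3 = \mathbb{C}[x, y, z]/(x^2, y^2, z^2)$. An element of \<open>3 \<Rightarrow>\<^sub>0 nat\<close> is the exponent
  vector of a monomial in the three variables \<open>X3 0\<close>, \<open>X3 1\<close>, \<open>X3 2\<close>.
\<close>

type_synonym poly3 = "(3 \<Rightarrow>\<^sub>0 nat) \<Rightarrow>\<^sub>0 complex"

definition X3 :: "3 \<Rightarrow> poly3"
  where "X3 i = Poly_Mapping.single (Poly_Mapping.single i 1) 1"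

definition const3 :: "complex \<Rightarrow> poly3"
  where "const3 c = Poly_Mapping.single 0 c"

definition ideal3 :: "poly3 set"
  where "ideal3 = {a * X3 0 ^ 2 + b * X3 1 ^ 2 + c * X3 2 ^ 2 | a b c. True}"

lemma ideal3_zero: "0 \<in> ideal3"
  unfolding ideal3_def by (rule CollectI, intro exI[of _ 0]) simp

lemma ideal3_add: "p \<in> ideal3 \<Longrightarrow> q \<in> ideal3 \<Longrightarrow> p + q \<in> ideal3"
proof -
  assume "p \<in> ideal3" "q \<in> ideal3"
  then obtain a b c a' b' c' where
    "p = a * X3 0 ^ 2 + b * X3 1 ^ 2 + c * X3 2 ^ 2"
    "q = a' * X3 0 ^ 2 + b' * X3 1 ^ 2 + c' * X3 2 ^ 2"
    unfolding ideal3_def by blast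
  then have "p + q = (a + a') * X3 0 ^ 2 + (b + b') * X3 1 ^ 2 + (c + c') * X3 2 ^ 2"
    by (simp add: algebra_simps)
  then show ?thesis
    unfolding ideal3_def by blast
qed

lemma ideal3_mult: "p \<in> ideal3 \<Longrightarrow> r * p \<in> ideal3"
proof -
  assume "p \<in> ideal3"
  then obtain a b c where "p = a * X3 0 ^ 2 + b * X3 1 ^ 2 + c * X3 2 ^ 2"
    unfolding ideal3_def by blast
  then have "r * p = (r * a) * X3 0 ^ 2 + (r * b) * X3 1 ^ 2 + (r * c) * X3 2 ^ 2"
    by (simp add: algebra_simps)
  then show ?thesis
    unfolding ideal3_def by blast
qed

lemma ideal3_uminus: "p \<in> ideal3 \<Longrightarrow> - p \<in> ideal3"
  using ideal3_mult[of p "- 1"] by simp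

lemma ideal3_gen: "X3 i ^ 2 \<in> ideal3"
proof -
  have *: "a * X3 0 ^ 2 + b * X3 1 ^ 2 + c * X3 2 ^ 2 \<in> ideal3" for a b c
    unfolding ideal3_def by blast
  have "i = 0 \<or> i = 1 \<or> i = 2"
    using exhaust_3[of i] by auto
  then show ?thesis
    using *[of 1 0 0] *[of 0 1 0] *[of 0 0 1] by auto
qed

lemma lookup_mult_X3_sq:
  assumes "Poly_Mapping.lookup m i < 2"
  shows "Poly_Mapping.lookup (a * X3 i ^ 2) m = 0"
proof -
  have X: "X3 i ^ 2 = Poly_Mapping.single (Poly_Mapping.single i 2) 1"
    by (simp add: X3_def power2_eq_square mult_single numeral_2_eq_2 flip: single_add)
  have "m \<noteq> l + Poly_Mapping.single i 2" for l
    using assms by (auto simp: lookup_add)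
  then have "(Poly_Mapping.lookup (X3 i ^ 2) q when m = l + q) = 0" for l q
    by (auto simp: X lookup_single when_def)
  then show ?thesis
    by (simp add: lookup_mult)
qed

lemma lookup_ideal3:
  assumes "p \<in> ideal3" and "\<And>i. Poly_Mapping.lookup m i < 2"
  shows "Poly_Mapping.lookup p m = 0"
  using assms unfolding ideal3_def by (auto simp: lookup_add lookup_mult_X3_sq)

lemma poly_mapping_sum_monomials:
  "(\<Sum>m\<in>Poly_Mapping.keys p. Poly_Mapping.single m (Poly_Mapping.lookup p m)) = p"
  by (rule poly_mapping_eqI)
    (auto simp: lookup_sum lookup_single when_def in_keys_iff)

lemma ideal3I:
  assumes "\<And>m. (\<And>i. Poly_Mapping.lookup m i < 2) \<Longrightarrow> Poly_Mapping.lookup p m = 0"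
  shows "p \<in> ideal3"
proof -
  have mono: "Poly_Mapping.single m c \<in> ideal3" if "\<not> (\<forall>i. Poly_Mapping.lookup m i < 2)" for m c
  proof -
    from that obtain i where i: "2 \<le> Poly_Mapping.lookup m i"
      by (meson not_less)
    let ?l = "m - Poly_Mapping.single i 2"
    have "m = ?l + Poly_Mapping.single i 2"
      using i by (intro poly_mapping_eqI) (auto simp: lookup_add lookup_minus lookup_single when_def)
    moreover have "X3 i ^ 2 = Poly_Mapping.single (Poly_Mapping.single i 2) 1"
      by (simp add: X3_def power2_eq_square mult_single numeral_2_eq_2 flip: single_add)
    ultimately have "Poly_Mapping.single m c = Poly_Mapping.single ?l c * X3 i ^ 2"
      by (metis mult.right_neutral mult_single)
    then show ?thesis
      using ideal3_gen ideal3_mult by metis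
  qed
  have "(\<Sum>m\<in>K. Poly_Mapping.single m (Poly_Mapping.lookup p m)) \<in> ideal3" if "finite K" "K \<subseteq> Poly_Mapping.keys p" for K
    using that
  proof (induction K)
    case empty
    then show ?case by (simp add: ideal3_zero)
  next
    case (insert m K)
    then have "\<not> (\<forall>i. Poly_Mapping.lookup m i < 2)"
      using assms by (auto simp: in_keys_iff)
    with insert show ?case
      by (auto intro: ideal3_add mono)
  qed
  from this[of "Poly_Mapping.keys p"] show ?thesis
    by (simp add: poly_mapping_sum_monomials)
qed

quotient_type A3 = poly3 / "\<lambda>p q. p - q \<in> ideal3"
proof (rule equivpI)
  show "reflp (\<lambda>p q. p - q \<in> ideal3)"
    by (simp add: reflp_def ideal3_zero)
  show "symp (\<lambda>p q. p - q \<in> ideal3)"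
    using ideal3_uminus by (force simp: symp_def)
  show "transp (\<lambda>p q. p - q \<in> ideal3)"
    unfolding transp_def
  proof (intro allI impI)
    fix p q r
    assume "p - q \<in> ideal3" "q - r \<in> ideal3"
    then have "(p - q) + (q - r) \<in> ideal3"
      by (rule ideal3_add)
    then show "p - r \<in> ideal3"
      by simp
  qed
qed

instantiation A3 :: comm_ring_1
begin

lift_definition zero_A3 :: A3 is 0 .
lift_definition one_A3 :: A3 is 1 .
lift_definition plus_A3 :: "A3 \<Rightarrow> A3 \<Rightarrow> A3" is "(+)"
  using ideal3_add by (fastforce simp: add_diff_add)
lift_definition uminus_A3 :: "A3 \<Rightarrow> A3" is uminus
  using ideal3_uminus by (fastforce simp: minus_diff_minus)
lift_definition minus_A3 :: "A3 \<Rightarrow> A3 \<Rightarrow> A3" is "(-)"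
proof -
  fix p p' q q' :: poly3
  assume "p - p' \<in> ideal3" "q - q' \<in> ideal3"
  then have "(p - p') + - (q - q') \<in> ideal3"
    by (intro ideal3_add ideal3_uminus)
  then show "p - q - (p' - q') \<in> ideal3"
    by (simp add: algebra_simps)
qed
lift_definition times_A3 :: "A3 \<Rightarrow> A3 \<Rightarrow> A3" is "(*)"
proof -
  fix p p' q q' :: poly3
  assume "p - p' \<in> ideal3" "q - q' \<in> ideal3"
  then have "q * (p - p') + p' * (q - q') \<in> ideal3"
    by (intro ideal3_add ideal3_mult)
  then show "p * q - p' * q' \<in> ideal3"
    by (simp add: algebra_simps)
qed

instance
proof
  show "(0::A3) \<noteq> 1"
  proof (transfer, rule notI)
    assume "0 - 1 \<in> ideal3"
    from lookup_ideal3[OF this, of 0] show False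
      by (simp add: lookup_minus lookup_one)
  qed
qed (transfer; simp add: algebra_simps ideal3_zero)+

end

lift_definition scale_A3 :: "complex \<Rightarrow> A3 \<Rightarrow> A3" is "\<lambda>c p. const3 c * p"
  by (simp add: ideal3_mult flip: right_diff_distrib)

lemma const3_add: "const3 (a + b) = const3 a + const3 b"
  by (simp add: const3_def single_add)

lemma const3_mult: "const3 (a * b) = const3 a * const3 b"
  by (simp add: const3_def mult_single)

lemma const3_1: "const3 1 = 1"
  by (simp add: const3_def)

lemma lookup_const3_mult: "Poly_Mapping.lookup (const3 c * p) m = c * Poly_Mapping.lookup p m"
proof -
  have "Poly_Mapping.lookup (const3 c * Poly_Mapping.single l d) m = c * Poly_Mapping.lookup (Poly_Mapping.single l d) m" for l d
    by (simp add: const3_def mult_single lookup_single when_def)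
  then have "Poly_Mapping.lookup (const3 c * (\<Sum>l\<in>Poly_Mapping.keys p. Poly_Mapping.single l (Poly_Mapping.lookup p l))) m =
      c * Poly_Mapping.lookup (\<Sum>l\<in>Poly_Mapping.keys p. Poly_Mapping.single l (Poly_Mapping.lookup p l)) m"
    by (simp add: sum_distrib_left lookup_sum)
  then show ?thesis
    by (simp add: poly_mapping_sum_monomials)
qed

interpretation A1: vector_space scale_A1
  by unfold_locales (transfer; simp add: smult_add_right smult_add_left)+

interpretation A3: vector_space scale_A3
  by unfold_locales
    (transfer; simp add: algebra_simps ideal3_zero const3_add const3_mult const3_1)+

text \<open>The algebras have dimensions 2 and 8, so bases with these index types exist.\<close>

lemma is_basisI:
  fixes sc :: "complex \<Rightarrow> 'v \<Rightarrow> 'v::ab_group_add" and b :: "'n::finite \<Rightarrow> 'v" and \<phi> :: "'n \<Rightarrow> 'v \<Rightarrow> complex"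
  assumes "vector_space sc"
    and add: "\<And>n v w. \<phi> n (v + w) = \<phi> n v + \<phi> n w"
    and scale: "\<And>n c v. \<phi> n (sc c v) = c * \<phi> n v"
    and dual: "\<And>n k. \<phi> n (b k) = (if n = k then 1 else 0)"
    and expand: "\<And>v. v = (\<Sum>n\<in>UNIV. sc (\<phi> n v) (b n))"
  shows "is_basis sc b"
proof -
  interpret vector_space sc by fact
  have inj: "inj b"
    by (rule injI) (metis dual zero_neq_one)
  have zero: "\<phi> n 0 = 0" for n
    using add[of n 0 0] by simp
  have sum: "\<phi> n (sum h S) = (\<Sum>i\<in>S. \<phi> n (h i))" if "finite S" for n S and h :: "'n \<Rightarrow> 'v"
    using that by (induction S) (auto simp: add zero)
  have "u (b n) = 0" if "(\<Sum>v\<in>range b. sc (u v) v) = 0" for u n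
  proof -
    have "\<phi> n (\<Sum>k\<in>UNIV. sc (u (b k)) (b k)) = u (b n)"
      by (simp add: sum scale dual if_distrib[of "\<lambda>x. _ * x"] cong: if_cong)
    moreover have "(\<Sum>k\<in>UNIV. sc (u (b k)) (b k)) = 0"
      using that by (simp add: sum.reindex[OF inj])
    ultimately show ?thesis
      by (simp add: zero)
  qed
  then have "\<not> dependent (range b)"
    by (auto simp: dependent_finite)
  moreover have "v \<in> span (range b)" for v
    by (subst expand) (intro span_sum span_scale span_base rangeI)
  ultimately show ?thesis
    using inj unfolding is_basis_def by blast
qed

lemma A1_basis_exists: "\<exists>b :: 2 \<Rightarrow> A1. is_basis scale_A1 b"
proof -
  have coeff0: "coeff r i = 0" if "[:0, 1:] ^ 2 dvd r" "i < 2" for r :: "complex poly" and i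
    using that by (auto simp: dvd_def power2_eq_square coeff_pCons less_2_cases_iff)
  define \<phi> where "\<phi> n v = coeff (rep_A1 v) (if n = (0::2) then 0 else 1)" for n v
  have \<phi>_abs: "\<phi> n (abs_A1 p) = coeff p (if n = 0 then 0 else 1)" for n p
  proof -
    have "[:0, 1:] ^ 2 dvd rep_A1 (abs_A1 p) - p"
      by (rule Quotient3_rep_abs[OF Quotient3_A1]) simp
    from coeff0[OF this, of "if n = 0 then 0 else 1"] show ?thesis
      by (auto simp: \<phi>_def)
  qed
  define b where "b n = abs_A1 (monom 1 (if n = (0::2) then 0 else 1))" for n
  have UN: "(UNIV :: 2 set) = {0, 1}"
  proof -
    have "x \<in> {0, 1}" for x :: 2
      using exhaust_2[of x] by auto
    then show ?thesis by blast
  qed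
  have "is_basis scale_A1 b"
  proof (rule is_basisI[of _ \<phi>])
    show "vector_space scale_A1" ..
    show "\<phi> n (v + w) = \<phi> n v + \<phi> n w" for n v w
      by (induction v, induction w) (simp add: plus_A1.abs_eq \<phi>_abs)
    show "\<phi> n (scale_A1 c v) = c * \<phi> n v" for n c v
      by (induction v) (simp add: scale_A1.abs_eq \<phi>_abs)
    show "\<phi> n (b k) = (if n = k then 1 else 0)" for n k
      using UN by (auto simp: b_def \<phi>_abs)
    show "v = (\<Sum>n\<in>UNIV. scale_A1 (\<phi> n v) (b n))" for v
    proof (induction v)
      case (1 p)
      have "[:0, 1:] ^ 2 dvd p - (smult (coeff p 0) (monom 1 0) + smult (coeff p 1) (monom 1 1))"
      proof (cases p rule: pCons_cases)
        case (pCons x q)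
        show ?thesis
        proof (cases q rule: pCons_cases)
          case q: (pCons y r)
          have "p - (smult (coeff p 0) (monom 1 0) + smult (coeff p 1) (monom 1 1)) = [:0, 1:] ^ 2 * r"
            by (simp add: pCons q monom_0 monom_Suc power2_eq_square)
          then show ?thesis by simp
        qed
      qed
      then show ?case
        unfolding UN by (simp add: \<phi>_abs b_def scale_A1.abs_eq plus_A1.abs_eq A1.abs_eq_iff)
    qed
  qed
  then show ?thesis by blast
qed

lemma A3_basis_exists: "\<exists>b :: 8 \<Rightarrow> A3. is_basis scale_A3 b"
proof -
  let ?S = "{m :: 3 \<Rightarrow>\<^sub>0 nat. \<forall>i. Poly_Mapping.lookup m i < 2}"
  have "bij_betw (\<lambda>h. Abs_poly_mapping (\<lambda>i. of_bool (h i))) (UNIV :: (3 \<Rightarrow> bool) set) ?S"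
  proof (rule bij_betwI[where g = "\<lambda>m i. Poly_Mapping.lookup m i = 1"])
    fix m assume "m \<in> ?S"
    then have "of_bool (Poly_Mapping.lookup m i = 1) = Poly_Mapping.lookup m i" for i
      by (auto simp: less_2_cases_iff)
    then show "Abs_poly_mapping (\<lambda>i. of_bool (Poly_Mapping.lookup m i = 1)) = m"
      by simp
  qed auto
  then have "card ?S = CARD(3 \<Rightarrow> bool)"
    by (simp add: bij_betw_same_card)
  then have "card ?S = CARD(8)"
    by (simp add: card_fun)
  then obtain h where h: "bij_betw h (UNIV :: 8 set) ?S"
    using finite_same_card_bij[of "UNIV :: 8 set" ?S] card_ge_0_finite[of ?S] by auto
  have h_eq: "h n = h k \<longleftrightarrow> n = k" for n k
    using bij_betw_imp_inj_on[OF h] by (rule inj_eq)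
  have hS: "Poly_Mapping.lookup (h n) i < 2" for n i
    using bij_betwE[OF h] by simp
  define \<phi> where "\<phi> n v = Poly_Mapping.lookup (rep_A3 v) (h n)" for n v
  have \<phi>_abs: "\<phi> n (abs_A3 p) = Poly_Mapping.lookup p (h n)" for n p
  proof -
    have "rep_A3 (abs_A3 p) - p \<in> ideal3"
      by (rule Quotient3_rep_abs[OF Quotient3_A3]) (simp add: ideal3_zero)
    from lookup_ideal3[OF this hS] show ?thesis
      by (simp add: \<phi>_def lookup_minus)
  qed
  define b where "b n = abs_A3 (Poly_Mapping.single (h n) 1)" for n
  have "is_basis scale_A3 b"
  proof (rule is_basisI[of _ \<phi>])
    show "vector_space scale_A3" ..
    show "\<phi> n (v + w) = \<phi> n v + \<phi> n w" for n v w
      by (induction v, induction w) (simp add: plus_A3.abs_eq \<phi>_abs lookup_add)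
    show "\<phi> n (scale_A3 c v) = c * \<phi> n v" for n c v
      by (induction v) (simp add: scale_A3.abs_eq \<phi>_abs lookup_const3_mult)
    show "\<phi> n (b k) = (if n = k then 1 else 0)" for n k
      by (simp add: b_def \<phi>_abs lookup_single when_def h_eq)
    show "v = (\<Sum>n\<in>UNIV. scale_A3 (\<phi> n v) (b n))" for v
    proof (induction v)
      case (1 p)
      have abs_sum: "(\<Sum>n\<in>N. abs_A3 (q n)) = abs_A3 (\<Sum>n\<in>N. q n)" for N and q :: "8 \<Rightarrow> poly3"
        by (induction N rule: infinite_finite_induct) (simp_all add: zero_A3.abs_eq plus_A3.abs_eq)
      let ?q = "\<Sum>n\<in>UNIV. const3 (Poly_Mapping.lookup p (h n)) * Poly_Mapping.single (h n) 1"
      have "p - ?q \<in> ideal3"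
      proof (rule ideal3I)
        fix m :: "3 \<Rightarrow>\<^sub>0 nat" assume "\<And>i. Poly_Mapping.lookup m i < 2"
        then have "m \<in> range h"
          unfolding bij_betw_imp_surj_on[OF h] by simp
        then obtain k where k: "m = h k" ..
        show "Poly_Mapping.lookup (p - ?q) m = 0"
          by (simp add: k h_eq lookup_minus lookup_sum lookup_const3_mult lookup_single when_def
              if_distrib[of "\<lambda>x. _ * x"] cong: if_cong)
      qed
      then show ?case
        by (simp add: \<phi>_abs b_def scale_A3.abs_eq abs_sum A3.abs_eq_iff)
    qed
  qed
  then show ?thesis by blast
qed

definition tensor_prod3 ::
  "complex ^ 'a \<Rightarrow> complex ^ 'b \<Rightarrow> complex ^ 'c \<Rightarrow> ('a::finite, 'b::finite, 'c::finite) tensor3"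
  where "tensor_prod3 u v w = (\<chi> i j k. u $ i * v $ j * w $ k)"

definition sym_prod3 :: "complex ^ 'a \<Rightarrow> complex ^ 'a \<Rightarrow> complex ^ 'a \<Rightarrow> ('a::finite, 'a, 'a) tensor3"
  where "sym_prod3 u v w = (1 / 6) *\<^sub>R
    (tensor_prod3 u v w + tensor_prod3 u w v + tensor_prod3 v u w +
     tensor_prod3 v w u + tensor_prod3 w u v + tensor_prod3 w v u)"

definition x_CW :: "nat \<Rightarrow> complex ^ 8"
  where "x_CW i = axis (of_nat i) 1"

definition T_CW6 :: "(8, 8, 8) tensor3"
  where "T_CW6 = 3 *\<^sub>R sym_prod3 (x_CW 0) (x_CW 0) (x_CW 7) +
    3 *\<^sub>R (\<Sum>i = 1..6. sym_prod3 (x_CW 0) (x_CW i) (x_CW i))"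

end

theory Submission
  imports Defs
begin

text \<open>
  The tensors isomorphic to the multiplication tensor of an algebra are exactly its coordinate arrays
  for all choices of three bases.

  Kronecker power: products of the images of a basis of \<open>A1\<close> under the three embeddings of \<open>A1\<close>
  form a basis of \<open>A3\<close>, in which the coordinate array is literally the third Kronecker power.

  Non-isomorphism: contracting one factor of the Coppersmith--Winograd tensor with a vector gives
  a matrix that is either invertible or of rank at most 2, whereas multiplication by \<open>x\<close> on \<open>A3\<close>
  has rank 4.

  Degeneration: pairing with the coefficient of \<open>xyz\<close> makes the multiplication tensor of \<open>A3\<close>
  a symmetric trilinear form. Under the grading that scales \<open>x, y, z\<close> by \<open>t\<close> and \<open>yz, xz, xy\<close> by
  \<open>1 / t\<close>, only the terms in \<open>x, y, z\<close> alone change, by \<open>t\<^sup>3\<close>; as \<open>t\<close> tends to 0 what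
  remains is \<open>1\<close> times the hyperbolic form pairing \<open>x, y, z\<close> with \<open>yz, xz, xy\<close>, together with
  the term in \<open>1, 1, xyz\<close>. Diagonalising that form gives the Coppersmith--Winograd tensor.
\<close>

locale complex_algebra = vector_space sc
  for sc :: "complex \<Rightarrow> 'r \<Rightarrow> 'r::comm_ring_1" +
  assumes scale_mult_left: "sc c v * w = sc c (v * w)"
begin

lemma scale_mult_right: "v * sc c w = sc c (v * w)"
  using scale_mult_left[of c w v] by (simp add: mult.commute)

lemma basis_independent: "is_basis sc b \<Longrightarrow> independent (range b)"
  and basis_span: "is_basis sc b \<Longrightarrow> span (range b) = UNIV"
  and basis_inj: "is_basis sc b \<Longrightarrow> inj b"
  by (auto simp: is_basis_def)

lemma basis_expand:
  fixes b :: "'n::finite \<Rightarrow> 'r"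
  assumes "is_basis sc b"
  shows "(\<Sum>n\<in>UNIV. sc (representation (range b) v (b n)) (b n)) = v"
proof -
  have "(\<Sum>w\<in>range b. sc (representation (range b) v w) w) = v"
    using assms by (intro sum_representation_eq) (auto simp: is_basis_def)
  then show ?thesis
    by (simp add: sum.reindex[OF basis_inj[OF assms]])
qed

lemma basis_coord_unique:
  fixes b :: "'n::finite \<Rightarrow> 'r"
  assumes b: "is_basis sc b" and v: "v = (\<Sum>n\<in>UNIV. sc (c n) (b n))"
  shows "representation (range b) v (b k) = c k"
proof -
  have mem: "w \<in> span (range b)" for w
    using basis_span[OF b] by simp
  have "representation (range b) v (b k) =
      (\<Sum>n\<in>UNIV. representation (range b) (sc (c n) (b n)) (b k))"
    unfolding v using basis_independent[OF b] mem
    by (subst representation_sum) auto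
  also have "\<dots> = (\<Sum>n\<in>UNIV. c n * (if n = k then 1 else 0))"
  proof (rule sum.cong)
    fix n
    have "representation (range b) (b n) (b k) = (if n = k then 1 else 0)"
      using representation_basis[OF basis_independent[OF b], of "b n"] basis_inj[OF b]
      by (auto simp: inj_eq)
    then show "representation (range b) (sc (c n) (b n)) (b k) = c n * (if n = k then 1 else 0)"
      using representation_scale[OF basis_independent[OF b] mem] by simp
  qed simp
  finally show ?thesis
    by (simp add: if_distrib[of "\<lambda>x. _ * x"] cong: if_cong)
qed

lemma mult_tensor_expand:
  assumes "is_basis sc g"
  shows "e i * f j = (\<Sum>k\<in>UNIV. sc (mult_tensor sc e f g $ i $ j $ k) (g k))"
  using basis_expand[OF assms, of "e i * f j"] by (simp add: mult_tensor_def)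

lemma mult_tensor_unique:
  assumes "is_basis sc g" and "\<And>i j. e i * f j = (\<Sum>k\<in>UNIV. sc (T $ i $ j $ k) (g k))"
  shows "mult_tensor sc e f g = T"
  using basis_coord_unique[OF assms(1,2)] by (simp add: mult_tensor_def vec_eq_iff)

lemma scale_if: "sc (if P then c else d) v = (if P then sc c v else sc d v)"
  by simp

lemma sum_scale_if:
  fixes h :: "'n::finite \<Rightarrow> 'r"
  shows "(\<Sum>n\<in>UNIV. sc (if k = n then 1 else 0) (h n)) = h k"
  by (simp add: scale_if cong: if_cong)

lemma tensor_act_products:
  fixes P :: "complex ^ 'a::finite ^ 'd::finite" and Q :: "complex ^ 'b::finite ^ 'e::finite"
    and R :: "complex ^ 'c::finite ^ 'f::finite"
  assumes prod: "\<And>i j. e i * f j = (\<Sum>k\<in>UNIV. sc (T $ i $ j $ k) (g k))"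
    and g: "\<And>k. g k = (\<Sum>n\<in>UNIV. sc (R $ n $ k) (g' n))"
  shows "(\<Sum>i\<in>UNIV. sc (P $ l $ i) (e i)) * (\<Sum>j\<in>UNIV. sc (Q $ m $ j) (f j)) =
    (\<Sum>n\<in>UNIV. sc (tensor_act P Q R T $ l $ m $ n) (g' n))"
proof -
  have "(\<Sum>i\<in>UNIV. sc (P $ l $ i) (e i)) * (\<Sum>j\<in>UNIV. sc (Q $ m $ j) (f j)) =
      (\<Sum>i\<in>UNIV. \<Sum>j\<in>UNIV. \<Sum>k\<in>UNIV. \<Sum>n\<in>UNIV.
        sc (P $ l $ i * Q $ m $ j * R $ n $ k * T $ i $ j $ k) (g' n))"
    unfolding sum_product scale_mult_left scale_mult_right prod scale_sum_right scale_scale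
    by (subst g) (simp add: scale_sum_right mult_ac)
  also have "\<dots> = (\<Sum>n\<in>UNIV. \<Sum>i\<in>UNIV. \<Sum>j\<in>UNIV. \<Sum>k\<in>UNIV.
        sc (P $ l $ i * Q $ m $ j * R $ n $ k * T $ i $ j $ k) (g' n))"
    by (subst (3) sum.swap, subst (2) sum.swap, subst sum.swap) rule
  finally show ?thesis
    by (simp add: tensor_act_def scale_sum_left)
qed

lemma basis_change_invertible:
  fixes b :: "'n::finite \<Rightarrow> 'r" and b' :: "'m::finite \<Rightarrow> 'r"
  assumes b: "is_basis sc b" and b': "is_basis sc b'"
  shows "invertible (\<chi> m n. representation (range b) (b' m) (b n))"
proof -
  have *: "(\<chi> m n. representation (range u) (v m) (u n)) **
      (\<chi> n m. representation (range v) (u n) (v m)) = mat 1"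
    if u: "is_basis sc u" and v: "is_basis sc v"
    for u :: "'k::finite \<Rightarrow> 'r" and v :: "'l::finite \<Rightarrow> 'r"
  proof -
    have "(\<Sum>n\<in>UNIV. representation (range u) (v m) (u n) * representation (range v) (u n) (v l)) =
        (if m = l then 1 else 0)" for m l
    proof -
      let ?c = "\<lambda>l. \<Sum>n\<in>UNIV. representation (range u) (v m) (u n) * representation (range v) (u n) (v l)"
      have "(\<Sum>l\<in>UNIV. sc (?c l) (v l)) = (\<Sum>n\<in>UNIV. sc (representation (range u) (v m) (u n))
          (\<Sum>l\<in>UNIV. sc (representation (range v) (u n) (v l)) (v l)))"
        by (simp add: scale_sum_left scale_sum_right) (rule sum.swap)
      also have "\<dots> = v m"
        by (simp add: basis_expand u v)
      finally have "representation (range v) (v m) (v l) = ?c l"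
        by (intro basis_coord_unique[OF v]) simp
      moreover have "representation (range v) (v m) (v l) = (if m = l then 1 else 0)"
        by (rule basis_coord_unique[OF v]) (simp add: sum_scale_if)
      ultimately show ?thesis by simp
    qed
    then show ?thesis
      by (simp add: matrix_matrix_mult_def mat_def vec_eq_iff)
  qed
  show ?thesis
    unfolding invertible_def using *[OF b b'] *[OF b' b] by blast
qed

lemma mult_tensor_isomorphic:
  fixes e :: "'a::finite \<Rightarrow> 'r" and f :: "'b::finite \<Rightarrow> 'r" and g :: "'c::finite \<Rightarrow> 'r"
    and e' :: "'d::finite \<Rightarrow> 'r" and f' :: "'e::finite \<Rightarrow> 'r" and g' :: "'f::finite \<Rightarrow> 'r"
  assumes "is_basis sc e" "is_basis sc f" "is_basis sc g"
    and "is_basis sc e'" "is_basis sc f'" "is_basis sc g'"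
  shows "tensor_isomorphic (mult_tensor sc e f g) (mult_tensor sc e' f' g')"
proof -
  define P where "P = (\<chi> l i. representation (range e) (e' l) (e i))"
  define Q where "Q = (\<chi> m j. representation (range f) (f' m) (f j))"
  define R where "R = (\<chi> k n. representation (range g') (g k) (g' n))"
  have inv: "invertible P" "invertible Q" "invertible R"
    unfolding P_def Q_def R_def using assms by (intro basis_change_invertible; simp)+
  have "invertible (transpose R)"
    using inv(3) by (metis invertible_def matrix_transpose_mul transpose_mat)
  moreover have "mult_tensor sc e' f' g' = tensor_act P Q (transpose R) (mult_tensor sc e f g)"
  proof (rule mult_tensor_unique)
    show "is_basis sc g'" by fact
    have g: "g k = (\<Sum>n\<in>UNIV. sc (transpose R $ n $ k) (g' n))" for k
      by (simp add: R_def transpose_def basis_expand assms)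
    show "e' l * f' m = (\<Sum>n\<in>UNIV. sc (tensor_act P Q (transpose R) (mult_tensor sc e f g) $ l $ m $ n) (g' n))"
      for l m
      unfolding tensor_act_products[OF mult_tensor_expand[OF assms(3)] g, symmetric]
      by (simp add: P_def Q_def basis_expand assms)
  qed
  ultimately show ?thesis
    unfolding tensor_isomorphic_def tensor_orbit_def using inv by blast
qed

lemma spanning_family_is_basis:
  fixes b :: "'n::finite \<Rightarrow> 'r" and b' :: "'m::finite \<Rightarrow> 'r"
  assumes b: "is_basis sc b" and span: "span (range b') = UNIV" and card: "CARD('m) = CARD('n)"
  shows "is_basis sc b'"
proof -
  interpret finite_dimensional_vector_space sc "range b"
    using b by unfold_locales (auto simp: is_basis_def)
  have dim: "dim (UNIV :: 'r set) = CARD('m)"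
    using b card by (simp add: dim_UNIV card_image is_basis_def)
  have le: "dim (UNIV :: 'r set) \<le> card (range b')"
    by (rule dim_le_card) (auto simp: span)
  have "card (range b') = CARD('m)"
    using le dim card_image_le[of "UNIV :: 'm set" b'] by simp
  then have "inj b'"
    by (simp add: eq_card_imp_inj_on)
  moreover have "independent (range b')"
    by (rule card_le_dim_spanning[of _ UNIV]) (use le dim card_image_le[of "UNIV :: 'm set" b'] span in auto)
  ultimately show ?thesis
    using span by (simp add: is_basis_def)
qed

lemma dual_functionals_independent:
  fixes b :: "'n::finite \<Rightarrow> 'r"
  assumes add: "\<And>n v w. \<phi> n (v + w) = \<phi> n v + \<phi> n w"
    and scale: "\<And>n c v. \<phi> n (sc c v) = c * \<phi> n v"
    and dual: "\<And>n k. \<phi> n (b k) = (if n = k then 1 else 0)"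
  shows "inj b" and "independent (range b)" and "\<phi> n (\<Sum>k\<in>UNIV. sc (c k) (b k)) = c n"
proof -
  show inj: "inj b"
    by (rule injI) (metis dual zero_neq_one)
  have zero: "\<phi> n 0 = 0" for n
    using add[of n 0 0] by simp
  have sum: "\<phi> n (sum h S) = (\<Sum>i\<in>S. \<phi> n (h i))" if "finite S" for n S and h :: "'n \<Rightarrow> 'r"
    using that by (induction S) (auto simp: add zero)
  show *: "\<phi> n (\<Sum>k\<in>UNIV. sc (c k) (b k)) = c n" for c n
    by (simp add: sum scale dual if_distrib[of "\<lambda>x. _ * x"] cong: if_cong)
  have "u (b n) = 0" if "(\<Sum>v\<in>range b. sc (u v) v) = 0" for u n
    using *[of n "\<lambda>k. u (b k)"] that by (simp add: sum.reindex[OF inj] zero)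
  then show "independent (range b)"
    by (auto simp: dependent_finite)
qed

lemma dual_functionals_is_basis:
  fixes b :: "'n::finite \<Rightarrow> 'r" and b' :: "'m::finite \<Rightarrow> 'r"
  assumes b': "is_basis sc b'" and card: "CARD('n) = CARD('m)"
    and "\<And>n v w. \<phi> n (v + w) = \<phi> n v + \<phi> n w"
    and "\<And>n c v. \<phi> n (sc c v) = c * \<phi> n v"
    and "\<And>n k. \<phi> n (b k) = (if n = k then 1 else 0)"
  shows "is_basis sc b" and "representation (range b) v (b n) = \<phi> n v"
proof -
  note ind = dual_functionals_independent[of \<phi> b, OF assms(3-5)]
  interpret finite_dimensional_vector_space sc "range b'"
    using b' by unfold_locales (auto simp: is_basis_def)
  have dim: "dim (UNIV :: 'r set) = card (range b)"
    using b' ind(1) card by (simp add: dim_UNIV card_image is_basis_def)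
  have "span (range b) = UNIV"
    using card_ge_dim_independent[of "range b" UNIV] ind dim by auto
  then show *: "is_basis sc b"
    using ind by (simp add: is_basis_def)
  show "representation (range b) v (b n) = \<phi> n v"
    using ind(3)[of n "\<lambda>k. representation (range b) v (b k)"] by (simp add: basis_expand[OF *])
qed

lemma invertible_combination_is_basis:
  fixes b :: "'n::finite \<Rightarrow> 'r" and P :: "complex ^ 'n ^ 'n"
  assumes b: "is_basis sc b" and "invertible P"
  shows "is_basis sc (\<lambda>l. \<Sum>i\<in>UNIV. sc (P $ l $ i) (b i))" (is "is_basis sc ?b'")
proof (rule spanning_family_is_basis[OF b])
  obtain S where S: "S ** P = mat 1"
    using assms unfolding invertible_def by blast
  have "b n \<in> span (range ?b')" for n
  proof -
    have "(\<Sum>l\<in>UNIV. sc (S $ n $ l) (?b' l)) = (\<Sum>i\<in>UNIV. sc ((S ** P) $ n $ i) (b i))"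
      by (simp add: matrix_matrix_mult_def scale_sum_left scale_sum_right) (rule sum.swap)
    also have "\<dots> = b n"
      by (simp add: S mat_def sum_scale_if)
    moreover have "(\<Sum>l\<in>UNIV. sc (S $ n $ l) (?b' l)) \<in> span (range ?b')"
      by (intro span_sum span_scale span_base rangeI)
    ultimately show ?thesis
      by simp
  qed
  then show "span (range ?b') = UNIV"
    using span_minimal[of "range b" "span (range ?b')"] basis_span[OF b] by auto
qed simp

lemma tensor_isomorphic_imp_mult_tensor:
  fixes e :: "'a::finite \<Rightarrow> 'r" and f :: "'b::finite \<Rightarrow> 'r" and g :: "'c::finite \<Rightarrow> 'r"
    and T :: "('a, 'b, 'c) tensor3"
  assumes "is_basis sc e" "is_basis sc f" "is_basis sc g"
    and "tensor_isomorphic (mult_tensor sc e f g) T"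
  obtains e' :: "'a \<Rightarrow> 'r" and f' :: "'b \<Rightarrow> 'r" and g' :: "'c \<Rightarrow> 'r"
  where "is_basis sc e'" "is_basis sc f'" "is_basis sc g'" "T = mult_tensor sc e' f' g'"
proof -
  obtain P Q R where T: "T = tensor_act P Q R (mult_tensor sc e f g)"
    and inv: "invertible P" "invertible Q" "invertible R"
    using assms(4) unfolding tensor_isomorphic_def tensor_orbit_def by blast
  obtain S where S: "R ** S = mat 1" "S ** R = mat 1"
    using inv unfolding invertible_def by blast
  define g' where "g' n = (\<Sum>k\<in>UNIV. sc (transpose S $ n $ k) (g k))" for n
  have g': "is_basis sc g'"
    unfolding g'_def using S assms(3)
    by (intro invertible_combination_is_basis) (metis invertible_def matrix_transpose_mul transpose_mat)+
  have g: "g k = (\<Sum>n\<in>UNIV. sc (R $ n $ k) (g' n))" for k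
  proof -
    have "(\<Sum>n\<in>UNIV. sc (R $ n $ k) (g' n)) = (\<Sum>i\<in>UNIV. sc ((S ** R) $ i $ k) (g i))"
      by (simp add: g'_def transpose_def matrix_matrix_mult_def scale_sum_left scale_sum_right mult.commute)
        (rule sum.swap)
    also have "\<dots> = g k"
      using sum_scale_if[of k g] by (simp add: S mat_def eq_commute)
    finally show ?thesis ..
  qed
  show thesis
  proof (rule that)
    show "is_basis sc (\<lambda>l. \<Sum>i\<in>UNIV. sc (P $ l $ i) (e i))"
      "is_basis sc (\<lambda>m. \<Sum>j\<in>UNIV. sc (Q $ m $ j) (f j))"
      using inv assms by (auto intro: invertible_combination_is_basis)
    show "is_basis sc g'" by fact
    show "T = mult_tensor sc (\<lambda>l. \<Sum>i\<in>UNIV. sc (P $ l $ i) (e i)) (\<lambda>m. \<Sum>j\<in>UNIV. sc (Q $ m $ j) (f j)) g'"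
      unfolding T
      by (rule mult_tensor_unique[symmetric, OF g'],
          rule tensor_act_products[OF mult_tensor_expand[OF assms(3)] g])
  qed
qed

end

interpretation A1: complex_algebra scale_A1
  by unfold_locales (transfer, simp)

interpretation A3: complex_algebra scale_A3
  by unfold_locales (transfer, simp add: mult.assoc ideal3_zero)

lemma cases_3: "i = 0 \<or> i = 1 \<or> i = 2" for i :: 3
  using exhaust_3[of i] by auto

lemma all_3: "(\<forall>i :: 3. P i) \<longleftrightarrow> P 0 \<and> P 1 \<and> P 2"
  using cases_3 by metis

definition var_A3 :: "3 \<Rightarrow> A3"
  where "var_A3 i = abs_A3 (X3 i)"

lemma var_A3_sq: "var_A3 i * var_A3 i = 0"
  using ideal3_gen[of i]
  by (simp add: var_A3_def times_A3.abs_eq zero_A3.abs_eq A3.abs_eq_iff power2_eq_square)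

lemma abs_A3_single:
  "abs_A3 (Poly_Mapping.single m c) =
    scale_A3 c (var_A3 0 ^ Poly_Mapping.lookup m 0 * var_A3 1 ^ Poly_Mapping.lookup m 1
      * var_A3 2 ^ Poly_Mapping.lookup m 2)"
proof -
  have X: "X3 i ^ n = Poly_Mapping.single (Poly_Mapping.single i n) 1" for i n
    by (induction n) (simp_all add: X3_def mult_single flip: single_add)
  have pow: "var_A3 i ^ n = abs_A3 (X3 i ^ n)" for i n
    by (induction n) (simp_all add: var_A3_def one_A3.abs_eq times_A3.abs_eq)
  have m: "m = Poly_Mapping.single 0 (Poly_Mapping.lookup m 0)
      + Poly_Mapping.single 1 (Poly_Mapping.lookup m 1) + Poly_Mapping.single 2 (Poly_Mapping.lookup m 2)"
  proof (rule poly_mapping_eqI)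
    fix i :: 3
    show "Poly_Mapping.lookup m i = Poly_Mapping.lookup (Poly_Mapping.single 0 (Poly_Mapping.lookup m 0)
      + Poly_Mapping.single 1 (Poly_Mapping.lookup m 1) + Poly_Mapping.single 2 (Poly_Mapping.lookup m 2)) i"
      using cases_3[of i] by (auto simp: lookup_add lookup_single)
  qed
  have "Poly_Mapping.single m c = const3 c * (X3 0 ^ Poly_Mapping.lookup m 0
      * X3 1 ^ Poly_Mapping.lookup m 1 * X3 2 ^ Poly_Mapping.lookup m 2)"
    by (subst m) (simp add: X const3_def mult_single)
  then show ?thesis
    by (simp add: pow times_A3.abs_eq scale_A3.abs_eq)
qed

lift_definition embed_A1 :: "3 \<Rightarrow> A1 \<Rightarrow> A3"
  is "\<lambda>i p. const3 (coeff p 0) + const3 (coeff p 1) * X3 i"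
proof -
  fix i and p q :: "complex poly"
  assume "[:0, 1:] ^ 2 dvd p - q"
  then obtain r where r: "p - q = [:0, 1:] ^ 2 * r" ..
  have "coeff (p - q) 0 = 0" "coeff (p - q) 1 = 0"
    unfolding r by (simp_all add: power2_eq_square)
  then show "const3 (coeff p 0) + const3 (coeff p 1) * X3 i
      - (const3 (coeff q 0) + const3 (coeff q 1) * X3 i) \<in> ideal3"
    by (simp add: ideal3_zero)
qed

lemma embed_A1_add: "embed_A1 i (v + w) = embed_A1 i v + embed_A1 i w"
  by transfer (simp add: const3_add algebra_simps ideal3_zero)

lemma embed_A1_scale: "embed_A1 i (scale_A1 c v) = scale_A3 c (embed_A1 i v)"
  by transfer (simp add: const3_mult algebra_simps ideal3_zero)

lemma embed_A1_mult: "embed_A1 i (v * w) = embed_A1 i v * embed_A1 i w"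
proof (transfer fixing: i)
  fix p q :: "complex poly"
  have "coeff (p * q) 1 = coeff p 0 * coeff q 1 + coeff p 1 * coeff q 0"
    by (simp add: coeff_mult)
  then have "const3 (coeff (p * q) 0) + const3 (coeff (p * q) 1) * X3 i
      - (const3 (coeff p 0) + const3 (coeff p 1) * X3 i) * (const3 (coeff q 0) + const3 (coeff q 1) * X3 i)
    = - const3 (coeff p 1) * const3 (coeff q 1) * X3 i ^ 2"
    by (simp add: coeff_mult_0 const3_add const3_mult algebra_simps power2_eq_square)
  then show "const3 (coeff (p * q) 0) + const3 (coeff (p * q) 1) * X3 i
      - (const3 (coeff p 0) + const3 (coeff p 1) * X3 i) * (const3 (coeff q 0) + const3 (coeff q 1) * X3 i)
      \<in> ideal3"
    by (simp only: ideal3_mult[OF ideal3_gen])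
qed

lemma embed_A1_sum: "embed_A1 i (sum h S) = (\<Sum>s\<in>S. embed_A1 i (h s))"
proof -
  have "embed_A1 i 0 = 0"
    using embed_A1_add[of i 0 0] by simp
  then show ?thesis
    by (induction S rule: infinite_finite_induct) (simp_all add: embed_A1_add)
qed

lemma embed_A1_one: "embed_A1 i 1 = 1"
  by transfer (simp add: const3_1 ideal3_zero, simp add: const3_def ideal3_zero)

lemma embed_A1_var: "embed_A1 i (abs_A1 [:0, 1:]) = var_A3 i"
  by (simp add: embed_A1.abs_eq var_A3_def const3_1) (simp add: const3_def)

definition tensor_cube :: "('n \<Rightarrow> A1) \<Rightarrow> 'n \<times> 'n \<times> 'n \<Rightarrow> A3"
  where "tensor_cube b p = embed_A1 0 (b (fst p)) * embed_A1 1 (b (fst (snd p))) * embed_A1 2 (b (snd (snd p)))"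

lemma tensor_cube_combination:
  fixes b :: "'n::finite \<Rightarrow> A1"
  shows "embed_A1 0 (\<Sum>i\<in>UNIV. scale_A1 (c i) (b i)) * embed_A1 1 (\<Sum>j\<in>UNIV. scale_A1 (c' j) (b j))
      * embed_A1 2 (\<Sum>k\<in>UNIV. scale_A1 (c'' k) (b k)) =
    (\<Sum>p\<in>UNIV. scale_A3 (c (fst p) * (c' (fst (snd p)) * c'' (snd (snd p)))) (tensor_cube b p))"
proof -
  have "embed_A1 0 (\<Sum>i\<in>UNIV. scale_A1 (c i) (b i)) * embed_A1 1 (\<Sum>j\<in>UNIV. scale_A1 (c' j) (b j))
      * embed_A1 2 (\<Sum>k\<in>UNIV. scale_A1 (c'' k) (b k)) =
    (\<Sum>i\<in>UNIV. \<Sum>j\<in>UNIV. \<Sum>k\<in>UNIV. scale_A3 (c i * (c' j * c'' k)) (tensor_cube b (i, j, k)))"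
    unfolding embed_A1_sum embed_A1_scale
    by (subst sum_product, simp only: sum_distrib_right, simp only: sum_distrib_left)
      (simp add: tensor_cube_def A3.scale_mult_left A3.scale_mult_right mult_ac)
  then show ?thesis
    by (simp add: sum.cartesian_product case_prod_beta)
qed

lemma tensor_cube_is_basis:
  fixes b :: "2 \<Rightarrow> A1"
  assumes b: "is_basis scale_A1 b"
  shows "is_basis scale_A3 (tensor_cube b)"
proof -
  obtain e :: "8 \<Rightarrow> A3" where e: "is_basis scale_A3 e"
    using A3_basis_exists ..
  let ?S = "A3.span (range (tensor_cube b))"
  have prod: "embed_A1 0 u * embed_A1 1 v * embed_A1 2 w \<in> ?S" for u v w
  proof -
    have "embed_A1 0 (\<Sum>i\<in>UNIV. scale_A1 (c i) (b i)) * embed_A1 1 (\<Sum>j\<in>UNIV. scale_A1 (c' j) (b j))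
      * embed_A1 2 (\<Sum>k\<in>UNIV. scale_A1 (c'' k) (b k)) \<in> ?S" for c c' c''
      unfolding tensor_cube_combination by (intro A3.span_sum A3.span_scale A3.span_base rangeI)
    from this[of "\<lambda>i. A1.representation (range b) u (b i)" "\<lambda>i. A1.representation (range b) v (b i)"
        "\<lambda>i. A1.representation (range b) w (b i)"] show ?thesis
      by (simp add: A1.basis_expand[OF b])
  qed
  have pow: "embed_A1 i (abs_A1 [:0, 1:] ^ n) = var_A3 i ^ n" for i n
    by (induction n) (simp_all add: embed_A1_one embed_A1_mult embed_A1_var)
  have single: "abs_A3 (Poly_Mapping.single m c) \<in> ?S" for m c
    unfolding abs_A3_single pow[symmetric] by (intro A3.span_scale prod)
  have "abs_A3 p \<in> ?S" for p
  proof -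
    have "abs_A3 (\<Sum>m\<in>K. Poly_Mapping.single m (Poly_Mapping.lookup p m)) \<in> ?S" for K
      by (induction K rule: infinite_finite_induct)
        (simp_all add: A3.span_zero A3.span_add single flip: zero_A3.abs_eq plus_A3.abs_eq)
    from this[of "Poly_Mapping.keys p"] show ?thesis
      by (simp add: poly_mapping_sum_monomials)
  qed
  then have "v \<in> ?S" for v
    by (induction v) simp
  then show ?thesis
    by (intro A3.spanning_family_is_basis[OF e]) auto
qed

lemma mult_tensor_tensor_cube:
  fixes a b c :: "2 \<Rightarrow> A1"
  assumes c: "is_basis scale_A1 c"
  defines "T \<equiv> mult_tensor scale_A1 a b c"
  shows "mult_tensor scale_A3 (tensor_cube a) (tensor_cube b) (tensor_cube c) = kronecker T (kronecker T T)"
proof (rule A3.mult_tensor_unique[OF tensor_cube_is_basis[OF c]])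
  fix p q
  have "tensor_cube a p * tensor_cube b q =
      embed_A1 0 (a (fst p) * b (fst q)) * embed_A1 1 (a (fst (snd p)) * b (fst (snd q)))
      * embed_A1 2 (a (snd (snd p)) * b (snd (snd q)))"
    by (simp add: tensor_cube_def embed_A1_mult mult_ac)
  also have "\<dots> = (\<Sum>r\<in>UNIV. scale_A3 (kronecker T (kronecker T T) $ p $ q $ r) (tensor_cube c r))"
    unfolding A1.mult_tensor_expand[OF c] tensor_cube_combination T_def by (simp add: kronecker_def)
  finally show "tensor_cube a p * tensor_cube b q =
    (\<Sum>r\<in>UNIV. scale_A3 (kronecker T (kronecker T T) $ p $ q $ r) (tensor_cube c r))" .
qed

text \<open>The coefficient of \<open>xyz\<close>, i.e. of the monomial with all exponents equal to 1.\<close>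

definition socle_coeff :: "A3 \<Rightarrow> complex"
  where "socle_coeff v = Poly_Mapping.lookup (rep_A3 v) (\<Sum>i\<in>UNIV. Poly_Mapping.single i 1)"

lemma socle_coeff_abs: "socle_coeff (abs_A3 p) = Poly_Mapping.lookup p (\<Sum>i\<in>UNIV. Poly_Mapping.single i 1)"
proof -
  have "rep_A3 (abs_A3 p) - p \<in> ideal3"
    by (rule Quotient3_rep_abs[OF Quotient3_A3]) (simp add: ideal3_zero)
  from lookup_ideal3[OF this, of "\<Sum>i\<in>UNIV. Poly_Mapping.single i 1"] show ?thesis
    by (simp add: socle_coeff_def lookup_minus lookup_sum lookup_single when_def)
qed

lemma socle_coeff_add: "socle_coeff (v + w) = socle_coeff v + socle_coeff w"
  by (induction v, induction w) (simp add: plus_A3.abs_eq socle_coeff_abs lookup_add)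

lemma socle_coeff_scale: "socle_coeff (scale_A3 c v) = c * socle_coeff v"
  by (induction v) (simp add: scale_A3.abs_eq socle_coeff_abs lookup_const3_mult)

lemma socle_coeff_zero: "socle_coeff 0 = 0"
  using socle_coeff_scale[of 0 0] by simp

lemma socle_coeff_monomial:
  "socle_coeff (var_A3 0 ^ i * var_A3 1 ^ j * var_A3 2 ^ k) = (if i = 1 \<and> j = 1 \<and> k = 1 then 1 else 0)"
proof -
  define m :: "3 \<Rightarrow>\<^sub>0 nat" where "m = Poly_Mapping.single 0 i + Poly_Mapping.single 1 j + Poly_Mapping.single 2 k"
  have m: "Poly_Mapping.lookup m 0 = i" "Poly_Mapping.lookup m 1 = j" "Poly_Mapping.lookup m 2 = k"
    by (simp_all add: m_def lookup_add lookup_single)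
  have one: "Poly_Mapping.lookup (\<Sum>i\<in>UNIV. Poly_Mapping.single i (1::nat)) n = 1" for n :: 3
    by (simp add: lookup_sum lookup_single when_def)
  have "m = (\<Sum>i\<in>UNIV. Poly_Mapping.single i 1) \<longleftrightarrow> i = 1 \<and> j = 1 \<and> k = 1"
    unfolding poly_mapping_eq_iff fun_eq_iff one using m all_3[of "\<lambda>n. Poly_Mapping.lookup m n = 1"] by simp
  moreover have "socle_coeff (abs_A3 (Poly_Mapping.single m 1)) =
      (if m = (\<Sum>i\<in>UNIV. Poly_Mapping.single i 1) then 1 else 0)"
    by (simp add: socle_coeff_abs lookup_single when_def)
  ultimately show ?thesis
    by (simp add: abs_A3_single m)
qed

abbreviation "x3 \<equiv> var_A3 0"
abbreviation "y3 \<equiv> var_A3 1"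
abbreviation "z3 \<equiv> var_A3 2"

lemma socle_coeff_simps:
  "socle_coeff 1 = 0" "socle_coeff x3 = 0" "socle_coeff y3 = 0" "socle_coeff z3 = 0"
  "socle_coeff (x3 * y3) = 0" "socle_coeff (x3 * z3) = 0" "socle_coeff (y3 * z3) = 0"
  "socle_coeff (x3 * (y3 * z3)) = 1"
  using socle_coeff_monomial[of 0 0 0] socle_coeff_monomial[of 1 0 0] socle_coeff_monomial[of 0 1 0]
    socle_coeff_monomial[of 0 0 1] socle_coeff_monomial[of 1 1 0] socle_coeff_monomial[of 1 0 1]
    socle_coeff_monomial[of 0 1 1] socle_coeff_monomial[of 1 1 1]
  by (simp_all add: mult.assoc)

lemma var_A3_sq_left: "var_A3 i * (var_A3 i * w) = 0"
  by (simp add: var_A3_sq flip: mult.assoc)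

lemma socle_coeff_uminus: "socle_coeff (- v) = - socle_coeff v"
  using socle_coeff_scale[of "- 1" v] by simp

lemmas A3_simps = socle_coeff_uminus socle_coeff_simps socle_coeff_add socle_coeff_scale socle_coeff_zero
  A3.scale_mult_left A3.scale_mult_right var_A3_sq var_A3_sq_left distrib_left distrib_right
  mult.assoc mult.commute[of y3 x3] mult.left_commute[of y3 x3] mult.commute[of z3 x3]
  mult.left_commute[of z3 x3] mult.commute[of z3 y3] mult.left_commute[of z3 y3]

lemma UNIV_8: "(UNIV :: 8 set) = {0, 1, 2, 3, 4, 5, 6, 7}"
proof -
  have "card {0, 1, 2, 3, 4, 5, 6, 7 :: 8} = CARD(8)"
    by simp
  then show ?thesis
    by (metis card_subset_eq finite subset_UNIV)
qed

lemma cases_8: "i = 0 \<or> i = 1 \<or> i = 2 \<or> i = 3 \<or> i = 4 \<or> i = 5 \<or> i = 6 \<or> i = 7" for i :: 8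
  using UNIV_I[of i] unfolding UNIV_8 by simp

text \<open>
  The pairing \<open>socle_coeff (cw_basis t i * cw_basis t j)\<close> below has matrix \<open>of_bool (swap07 i = j)\<close>,
  so \<open>swap07\<close> turns \<open>cw_basis t\<close> into its dual basis.
\<close>

definition swap07 :: "8 \<Rightarrow> 8"
  where "swap07 i = (if i = 0 then 7 else if i = 7 then 0 else i)"

lemma T_CW6_nth:
  "T_CW6 $ i $ j $ k =
    (if i = 0 then of_bool (swap07 j = k) else if j = 0 then of_bool (swap07 i = k)
     else if k = 0 then of_bool (swap07 i = j) else 0)"
proof -
  let ?d = "\<lambda>i n. of_bool (i = (of_nat n :: 8)) :: complex"
  have sym: "(3 *\<^sub>R sym_prod3 (x_CW 0) (x_CW n) (x_CW m)) $ i $ j $ k = (1 / 2) *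
    (?d i 0 * ?d j n * ?d k m + ?d i 0 * ?d j m * ?d k n + ?d i n * ?d j 0 * ?d k m
      + ?d i n * ?d j m * ?d k 0 + ?d i m * ?d j 0 * ?d k n + ?d i m * ?d j n * ?d k 0)" for n m
    unfolding sym_prod3_def tensor_prod3_def x_CW_def axis_def vector_scaleR_component scaleR_scaleR
    unfolding scaleR_conv_of_real by (simp add: of_bool_def)
  have sum: "(\<Sum>n = 1..6. ?d i n * ?d j n) = of_bool (i = j \<and> i \<noteq> 0 \<and> i \<noteq> 7)" for i j
  proof -
    have eq: "{1..6} = {1, 2, 3, 4, 5, 6 :: nat}" by auto
    show ?thesis
      unfolding eq using cases_8[of i] by (elim disjE) auto
  qed
  have "T_CW6 $ i $ j $ k = (3 *\<^sub>R sym_prod3 (x_CW 0) (x_CW 0) (x_CW 7)) $ i $ j $ k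
      + (\<Sum>n = 1..6. (3 *\<^sub>R sym_prod3 (x_CW 0) (x_CW n) (x_CW n)) $ i $ j $ k)"
    by (simp add: T_CW6_def scaleR_sum_right)
  also have "(\<Sum>n = 1..6. (3 *\<^sub>R sym_prod3 (x_CW 0) (x_CW n) (x_CW n)) $ i $ j $ k) =
      (\<Sum>n = 1..6. ?d i 0 * (?d j n * ?d k n) + ?d j 0 * (?d i n * ?d k n) + ?d k 0 * (?d i n * ?d j n))"
    unfolding sym by (intro sum.cong) (simp_all add: mult_ac)
  also have "\<dots> = ?d i 0 * of_bool (j = k \<and> j \<noteq> 0 \<and> j \<noteq> 7)
      + ?d j 0 * of_bool (i = k \<and> i \<noteq> 0 \<and> i \<noteq> 7) + ?d k 0 * of_bool (i = j \<and> i \<noteq> 0 \<and> i \<noteq> 7)"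
    unfolding sum.distrib sum_distrib_left[symmetric] sum ..
  finally show ?thesis
    unfolding sym
    by (cases "i = 0"; cases "i = 7"; cases "j = 0"; cases "j = 7"; cases "k = 0"; cases "k = 7")
      (simp_all add: swap07_def)
qed

definition cw_linear :: "8 \<Rightarrow> A3"
  where "cw_linear i =
    (if i = 1 then x3 else if i = 2 then y3 else if i = 3 then z3
     else if i = 4 then scale_A3 \<i> x3 else if i = 5 then scale_A3 \<i> y3 else scale_A3 \<i> z3)"

definition cw_quadratic :: "8 \<Rightarrow> A3"
  where "cw_quadratic i =
    (if i = 1 then scale_A3 (1 / 2) (y3 * z3) else if i = 2 then scale_A3 (1 / 2) (x3 * z3)
     else if i = 3 then scale_A3 (1 / 2) (x3 * y3) else if i = 4 then scale_A3 (- \<i> / 2) (y3 * z3)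
     else if i = 5 then scale_A3 (- \<i> / 2) (x3 * z3) else scale_A3 (- \<i> / 2) (x3 * y3))"

definition cw_basis :: "complex \<Rightarrow> 8 \<Rightarrow> A3"
  where "cw_basis t i =
    (if i = 0 then 1 else if i = 7 then x3 * (y3 * z3)
     else scale_A3 t (cw_linear i) + scale_A3 (1 / t) (cw_quadratic i))"

lemma cw_linear_cases:
  obtains c where "cw_linear i = scale_A3 c x3" | c where "cw_linear i = scale_A3 c y3"
    | c where "cw_linear i = scale_A3 c z3"
proof -
  have "(\<exists>c. cw_linear i = scale_A3 c x3) \<or> (\<exists>c. cw_linear i = scale_A3 c y3)
      \<or> (\<exists>c. cw_linear i = scale_A3 c z3)"
    unfolding cw_linear_def by (auto intro: A3.scale_one[symmetric])
  then show thesis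
    using that by blast
qed

lemma cw_quadratic_cases:
  obtains c where "cw_quadratic i = scale_A3 c (y3 * z3)" | c where "cw_quadratic i = scale_A3 c (x3 * z3)"
    | c where "cw_quadratic i = scale_A3 c (x3 * y3)"
proof -
  have "(\<exists>c. cw_quadratic i = scale_A3 c (y3 * z3)) \<or> (\<exists>c. cw_quadratic i = scale_A3 c (x3 * z3))
      \<or> (\<exists>c. cw_quadratic i = scale_A3 c (x3 * y3))"
    unfolding cw_quadratic_def by (simp only: split: if_split) blast
  then show thesis
    using that by blast
qed

lemma cw_quadratic_mult: "cw_quadratic i * cw_quadratic j = 0"
  by (rule cw_quadratic_cases[of i]; rule cw_quadratic_cases[of j]) (simp_all add: A3_simps)

lemma cw_linear_quadratic_mult: "cw_linear i * (cw_linear j * cw_quadratic k) = 0"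
  by (rule cw_linear_cases[of i]; rule cw_linear_cases[of j]; rule cw_quadratic_cases[of k])
    (simp_all add: A3_simps)

lemma cw_linear_socle: "cw_linear i * (x3 * (y3 * z3)) = 0"
  by (rule cw_linear_cases[of i]) (simp_all add: A3_simps)

lemma cw_quadratic_socle: "cw_quadratic i * (x3 * (y3 * z3)) = 0"
  by (rule cw_quadratic_cases[of i]) (simp_all add: A3_simps)

lemma cw_basis_socle:
  assumes "i \<noteq> 0"
  shows "cw_basis t i * (x3 * (y3 * z3)) = 0"
  using assms by (simp add: cw_basis_def distrib_right A3.scale_mult_left cw_linear_socle
      cw_quadratic_socle) (simp add: A3_simps)

lemma socle_coeff_linear_mult: "socle_coeff (cw_linear i * cw_linear j) = 0"
  by (rule cw_linear_cases[of i]; rule cw_linear_cases[of j]) (simp_all add: A3_simps)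

lemma socle_coeff_linear_quadratic:
  assumes "i \<notin> {0, 7}" "j \<notin> {0, 7}"
  shows "socle_coeff (cw_linear i * cw_quadratic j) + socle_coeff (cw_quadratic i * cw_linear j) = of_bool (i = j)"
proof -
  have "i \<in> {1, 2, 3, 4, 5, 6}" "j \<in> {1, 2, 3, 4, 5, 6}"
    using cases_8[of i] cases_8[of j] assms by simp_all
  then show ?thesis
    unfolding insert_iff empty_iff
    by (elim disjE) (simp_all add: cw_linear_def cw_quadratic_def A3_simps)
qed

lemma socle_coeff_cw_basis:
  assumes t: "t \<noteq> 0"
  shows "socle_coeff (cw_basis t i * cw_basis t j) = of_bool (swap07 i = j)"
proof -
  have E0: "cw_basis t 0 = 1" and E7: "cw_basis t 7 = x3 * (y3 * z3)"
    by (simp_all add: cw_basis_def)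
  have one: "socle_coeff (cw_basis t i) = of_bool (i = 7)" for i
    by (rule cw_linear_cases[of i]; rule cw_quadratic_cases[of i])
      (simp_all add: cw_basis_def A3_simps)
  consider "i = 0" | "j = 0" "i \<noteq> 0" | "i \<noteq> 0" "j \<noteq> 0" "i = 7 \<or> j = 7" | "i \<notin> {0, 7}" "j \<notin> {0, 7}"
    by auto
  then show ?thesis
  proof cases
    case 3
    then have "cw_basis t i * cw_basis t j = 0"
      using cw_basis_socle[of i t] cw_basis_socle[of j t] E7 by (auto simp: mult.commute)
    then show ?thesis
      using 3 by (auto simp: socle_coeff_zero swap07_def)
  next
    case 4
    then have "socle_coeff (cw_basis t i * cw_basis t j) =
        socle_coeff (cw_linear i * cw_quadratic j) + socle_coeff (cw_quadratic i * cw_linear j)"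
      using t by (simp add: cw_basis_def distrib_left distrib_right A3.scale_mult_left A3.scale_mult_right
          socle_coeff_add socle_coeff_scale socle_coeff_linear_mult cw_quadratic_mult socle_coeff_zero)
    then show ?thesis
      using 4 socle_coeff_linear_quadratic[of i j] by (simp add: swap07_def)
  qed (auto simp: E0 one swap07_def)
qed

lemma cw_basis_mult3:
  assumes t: "t \<noteq> 0" and "i \<notin> {0, 7}" "j \<notin> {0, 7}" "k \<notin> {0, 7}"
  shows "cw_basis t i * cw_basis t j * cw_basis t k =
    scale_A3 (t ^ 3) (cw_linear i * cw_linear j * cw_linear k)"
proof -
  have zero: "cw_linear a * (cw_quadratic b * cw_linear c) = 0" "cw_quadratic a * (cw_linear b * cw_linear c) = 0"
    "cw_quadratic a * (cw_linear b * cw_quadratic c) = 0" "cw_quadratic a * (cw_quadratic b * cw_linear c) = 0"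
    for a b c
    using cw_linear_quadratic_mult[of a c b] cw_linear_quadratic_mult[of b c a]
      cw_quadratic_mult[of a c] cw_quadratic_mult[of a b]
    by (simp_all only: mult.commute mult.left_commute mult_zero_left mult_zero_right)
  show ?thesis
    using assms by (simp add: cw_basis_def distrib_left distrib_right mult.assoc A3.scale_mult_left
        A3.scale_mult_right zero cw_linear_quadratic_mult cw_quadratic_mult power3_eq_cube)
qed

lemma socle_coeff_cw_basis3:
  assumes t: "t \<noteq> 0"
  shows "socle_coeff (cw_basis t i * cw_basis t j * cw_basis t k) = T_CW6 $ i $ j $ k
    + t ^ 3 * (if {i, j, k} \<inter> {0, 7} = {} then socle_coeff (cw_linear i * cw_linear j * cw_linear k) else 0)"
proof -
  have E0: "cw_basis t 0 = 1" and E7: "cw_basis t 7 = x3 * (y3 * z3)"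
    by (simp_all add: cw_basis_def)
  consider "i = 0" | "j = 0" "i \<noteq> 0" | "k = 0" "i \<noteq> 0" "j \<noteq> 0"
    | "i \<noteq> 0" "j \<noteq> 0" "k \<noteq> 0" "i = 7 \<or> j = 7 \<or> k = 7" | "i \<notin> {0, 7}" "j \<notin> {0, 7}" "k \<notin> {0, 7}"
    by auto
  then show ?thesis
  proof cases
    case 4
    have zero: "cw_basis t l * cw_basis t 7 = 0" "cw_basis t 7 * cw_basis t l = 0" if "l \<noteq> 0" for l
      using cw_basis_socle[OF that] by (simp_all add: E7 mult.commute)
    have "cw_basis t i * cw_basis t j * cw_basis t k = 0"
      using 4 by (elim disjE) (simp_all add: zero mult.assoc)
    then show ?thesis
      using 4 by (auto simp: T_CW6_nth socle_coeff_zero)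
  next
    case 5
    then show ?thesis
      by (simp add: cw_basis_mult3[OF t] T_CW6_nth socle_coeff_scale)
  qed (simp_all add: E0 socle_coeff_cw_basis[OF t] T_CW6_nth)
qed

lemma swap07_swap07 [simp]: "swap07 (swap07 i) = i"
  by (simp add: swap07_def)

lemma cw_basis_is_basis:
  assumes t: "t \<noteq> 0"
  shows "is_basis scale_A3 (cw_basis t)" and "is_basis scale_A3 (\<lambda>k. cw_basis t (swap07 k))"
    and "A3.representation (range (\<lambda>k. cw_basis t (swap07 k))) v (cw_basis t (swap07 k)) =
      socle_coeff (v * cw_basis t k)"
proof -
  obtain e :: "8 \<Rightarrow> A3" where e: "is_basis scale_A3 e"
    using A3_basis_exists ..
  note dual = A3.dual_functionals_is_basis[OF e refl]
  show "is_basis scale_A3 (cw_basis t)"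
    by (rule dual(1)[of "\<lambda>n v. socle_coeff (v * cw_basis t (swap07 n))"])
      (auto simp: distrib_right socle_coeff_add A3.scale_mult_left socle_coeff_scale
        socle_coeff_cw_basis[OF t] swap07_def)
  have *: "socle_coeff (cw_basis t (swap07 k) * cw_basis t n) = (if n = k then 1 else 0)" for n k
    by (auto simp: socle_coeff_cw_basis[OF t])
  show "is_basis scale_A3 (\<lambda>k. cw_basis t (swap07 k))"
    "A3.representation (range (\<lambda>k. cw_basis t (swap07 k))) v (cw_basis t (swap07 k)) =
      socle_coeff (v * cw_basis t k)"
    by (rule dual[of "\<lambda>n v. socle_coeff (v * cw_basis t n)"];
        simp add: distrib_right socle_coeff_add A3.scale_mult_left socle_coeff_scale *)+
qed

lemma mult_tensor_A3_degenerates: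
  fixes e f g :: "8 \<Rightarrow> A3"
  assumes "is_basis scale_A3 e" "is_basis scale_A3 f" "is_basis scale_A3 g"
  shows "mult_tensor scale_A3 e f g \<unrhd> T_CW6"
proof -
  define S :: "(8, 8, 8) tensor3" where "S = (\<chi> i j k. if {i, j, k} \<inter> {0, 7} = {}
    then socle_coeff (cw_linear i * cw_linear j * cw_linear k) else 0)"
  define r where "r n = inverse (real (Suc n))" for n
  have r: "r n \<noteq> 0" for n
    by (simp add: r_def)
  have "T_CW6 + r n ^ 3 *\<^sub>R S \<in> tensor_orbit (mult_tensor scale_A3 e f g)" for n
  proof -
    let ?t = "complex_of_real (r n)"
    have t: "?t \<noteq> 0"
      using r by simp
    have "T_CW6 + r n ^ 3 *\<^sub>R S = mult_tensor scale_A3 (cw_basis ?t) (cw_basis ?t) (\<lambda>k. cw_basis ?t (swap07 k))"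
      by (simp add: vec_eq_iff mult_tensor_def cw_basis_is_basis(3)[OF t] socle_coeff_cw_basis3[OF t] S_def
          scaleR_conv_of_real[where 'a = complex])
    then show ?thesis
      using A3.mult_tensor_isomorphic[OF assms cw_basis_is_basis(1)[OF t] cw_basis_is_basis(1,2)[OF t]]
      by (simp add: tensor_isomorphic_def)
  qed
  moreover have "(\<lambda>n. T_CW6 + r n ^ 3 *\<^sub>R S) \<longlonglongrightarrow> T_CW6 + 0 ^ 3 *\<^sub>R S"
    unfolding r_def by (intro tendsto_intros LIMSEQ_inverse_real_of_nat)
  ultimately show ?thesis
    unfolding degenerates_to_def closure_sequential by (auto intro!: exI[of _ "\<lambda>n. T_CW6 + r n ^ 3 *\<^sub>R S"])
qed

lemma mult_tensor_A3_not_isomorphic_T_CW6: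
  fixes e f g :: "8 \<Rightarrow> A3"
  assumes "is_basis scale_A3 e" "is_basis scale_A3 f" "is_basis scale_A3 g"
  shows "\<not> tensor_isomorphic (mult_tensor scale_A3 e f g) T_CW6"
proof
  assume "tensor_isomorphic (mult_tensor scale_A3 e f g) T_CW6"
  then obtain e f g :: "8 \<Rightarrow> A3" where e: "is_basis scale_A3 e" and f: "is_basis scale_A3 f"
    and g: "is_basis scale_A3 g" and T: "T_CW6 = mult_tensor scale_A3 e f g"
    using A3.tensor_isomorphic_imp_mult_tensor[OF assms] by metis
  note expand = A3.mult_tensor_expand[OF g, of e _ f, folded T]
  have prod0: "e 0 * f m = g (swap07 m)" for m
    unfolding expand using A3.sum_scale_if[of "swap07 m" g] by (simp add: T_CW6_nth of_bool_def)
  have prod0': "e l * f 0 = g (swap07 l)" for l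
  proof (cases "l = 0")
    case False
    then show ?thesis
      unfolding expand using A3.sum_scale_if[of "swap07 l" g] by (simp add: T_CW6_nth of_bool_def)
  qed (simp add: prod0)
  have prod: "e l * f m = scale_A3 (of_bool (swap07 l = m)) (g 0)" if "l \<noteq> 0" "m \<noteq> 0" for l m
    unfolding expand using that by (simp add: T_CW6_nth A3.scale_if cong: if_cong)
  define u where "u l = A3.representation (range e) x3 (e l)" for l
  have x: "x3 = (\<Sum>l\<in>UNIV. scale_A3 (u l) (e l))"
    unfolding u_def by (simp add: A3.basis_expand[OF e])
  define c where "c m = (\<Sum>l\<in>- {0}. u l * of_bool (swap07 l = m))" for m
  have split: "sum h UNIV = h 0 + sum h (- {0})" for h :: "8 \<Rightarrow> A3"
    by (simp add: sum.remove[of UNIV 0] Compl_eq_Diff_UNIV)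
  have xf: "x3 * f m = scale_A3 (u 0) (g (swap07 m)) + scale_A3 (c m) (g 0)" if "m \<noteq> 0" for m
  proof -
    have "x3 * f m = scale_A3 (u 0) (e 0 * f m) + (\<Sum>l\<in>- {0}. scale_A3 (u l) (e l * f m))"
      by (simp add: x sum_distrib_right A3.scale_mult_left split distrib_right)
    also have "(\<Sum>l\<in>- {0}. scale_A3 (u l) (e l * f m)) = scale_A3 (c m) (g 0)"
      unfolding c_def A3.scale_sum_left using that by (intro sum.cong) (simp_all add: prod)
    finally show ?thesis
      by (simp add: prod0)
  qed
  \<comment> \<open>Otherwise multiplication by \<open>x\<close> would be onto, although \<open>x\<close> is nilpotent.\<close>
  have u0: "u 0 = 0"
  proof (rule ccontr)
    assume nz: "u 0 \<noteq> 0"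
    let ?I = "range ((*) x3)"
    have I: "A3.subspace ?I"
    proof (rule A3.subspaceI)
      show "0 \<in> ?I" by (metis mult_zero_right rangeI)
      show "v + w \<in> ?I" if "v \<in> ?I" "w \<in> ?I" for v w
        using that by (auto simp flip: distrib_left)
      show "scale_A3 a v \<in> ?I" if "v \<in> ?I" for a v
        using that by (auto simp flip: A3.scale_mult_right)
    qed
    have unscale: "v \<in> ?I" if "scale_A3 (u 0) v \<in> ?I" for v
      using A3.subspace_scale[OF I that, of "inverse (u 0)"] nz by simp
    have "c 7 = 0"
      unfolding c_def by (rule sum.neutral) (auto simp: swap07_def)
    then have "scale_A3 (u 0) (g 0) = x3 * f 7"
      by (simp add: xf swap07_def)
    then have g0: "g 0 \<in> ?I"
      by (simp add: unscale)
    have gm: "g (swap07 m) \<in> ?I" if "m \<noteq> 0" for m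
    proof (rule unscale)
      have "scale_A3 (u 0) (g (swap07 m)) = x3 * f m - scale_A3 (c m) (g 0)"
        using xf[OF that] by simp
      then show "scale_A3 (u 0) (g (swap07 m)) \<in> ?I"
        using A3.subspace_diff[OF I _ A3.subspace_scale[OF I g0]] by simp
    qed
    let ?s = "\<Sum>l\<in>- {0}. scale_A3 (u l) (g (swap07 l))"
    have "x3 * f 0 = scale_A3 (u 0) (g 7) + ?s"
      using prod0'[of 0]
      by (simp add: x sum_distrib_right A3.scale_mult_left split prod0' distrib_right) (simp add: swap07_def)
    then have "scale_A3 (u 0) (g 7) = x3 * f 0 - ?s"
      by simp
    moreover have "?s \<in> ?I"
      by (intro A3.subspace_sum[OF I] A3.subspace_scale[OF I] gm) simp
    then have "x3 * f 0 - ?s \<in> ?I"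
      by (rule A3.subspace_diff[OF I rangeI])
    ultimately have "scale_A3 (u 0) (g 7) \<in> ?I"
      by (simp only:)
    then have g7: "g 7 \<in> ?I"
      by (rule unscale)
    have "g n \<in> ?I" for n
    proof (cases "n = 7")
      case False
      then have "swap07 n \<noteq> 0"
        by (simp add: swap07_def)
      from gm[OF this] show ?thesis
        by simp
    qed (simp add: g7)
    then have "A3.span (range g) \<subseteq> ?I"
      by (intro A3.span_minimal I) auto
    then have "1 \<in> ?I"
      using A3.basis_span[OF g] by auto
    then obtain w where "1 = x3 * w" ..
    then have "x3 * (y3 * z3) = x3 * (x3 * w) * (y3 * z3)"
      by simp
    then have "x3 * (y3 * z3) = 0"
      by (simp add: var_A3_sq_left)
    then show False
      using socle_coeff_simps(8) socle_coeff_zero by simp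
  qed
  let ?B = "{x3 * f 0, g 0}"
  have xw: "x3 * w \<in> A3.span ?B" for w
  proof -
    have "x3 * f m \<in> A3.span ?B" for m
      by (cases "m = 0") (auto simp: xf u0 intro: A3.span_base A3.span_scale)
    then have "(\<Sum>m\<in>UNIV. scale_A3 (A3.representation (range f) w (f m)) (x3 * f m)) \<in> A3.span ?B"
      by (intro A3.span_sum A3.span_scale)
    also have "(\<Sum>m\<in>UNIV. scale_A3 (A3.representation (range f) w (f m)) (x3 * f m)) = x3 * w"
      by (subst A3.basis_expand[OF f, of w, symmetric]) (simp add: sum_distrib_left A3.scale_mult_right)
    finally show ?thesis .
  qed
  define b :: "3 \<Rightarrow> A3" where "b i = (if i = 0 then x3 else if i = 1 then x3 * y3 else x3 * z3)" for i
  define d :: "3 \<Rightarrow> A3" where "d i = (if i = 0 then y3 * z3 else if i = 1 then z3 else y3)" for i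
  have "socle_coeff (b k * d n) = (if n = k then 1 else 0)" for n k
    unfolding b_def d_def using cases_3[of n] cases_3[of k] by (elim disjE) (simp_all add: A3_simps)
  then have b: "inj b" "A3.independent (range b)"
    by (intro A3.dual_functionals_independent[of "\<lambda>n v. socle_coeff (v * d n)" b];
        simp add: distrib_right socle_coeff_add A3.scale_mult_left socle_coeff_scale)+
  have "b i \<in> A3.span ?B" for i
    using xw[of 1] xw[of y3] xw[of z3] by (simp add: b_def)
  then have "card (range b) \<le> card ?B"
    by (intro conjunct2[OF A3.independent_span_bound[OF _ b(2)]]) auto
  moreover have "card ?B \<le> 2"
    by (simp add: card_insert_if)
  ultimately show False
    using b(1) by (simp add: card_image)
qed

theorem mainTheorem5:
  fixes e f g :: "8 \<Rightarrow> A3" and a b c :: "2 \<Rightarrow> A1"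
  assumes "is_basis scale_A3 e" and "is_basis scale_A3 f" and "is_basis scale_A3 g"
    and "is_basis scale_A1 a" and "is_basis scale_A1 b" and "is_basis scale_A1 c"
  defines "T_A3 \<equiv> mult_tensor scale_A3 e f g"
    and "T_A1 \<equiv> mult_tensor scale_A1 a b c"
  shows "tensor_isomorphic T_A3 (kronecker T_A1 (kronecker T_A1 T_A1))
    \<and> \<not> tensor_isomorphic T_A3 T_CW6
    \<and> T_A3 \<unrhd> T_CW6"
proof -
  have "tensor_isomorphic T_A3 (mult_tensor scale_A3 (tensor_cube a) (tensor_cube b) (tensor_cube c))"
    unfolding T_A3_def by (intro A3.mult_tensor_isomorphic tensor_cube_is_basis assms)
  then show ?thesis
    using mult_tensor_A3_not_isomorphic_T_CW6[OF assms(1-3)] mult_tensor_A3_degenerates[OF assms(1-3)]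
    unfolding T_A3_def T_A1_def by (simp add: mult_tensor_tensor_cube assms)
qed

end
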